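(* Let $G=(V,E,w)$ be a directed graph with positive arc weights $w:E\to\mathbb{R}^{+}$, and let $C$ be a partition of $V$ into cells. Let $H$ be the overlay graph of $G$ with respect to $C$: its vertices are the boundary vertices (vertices having an arc to or from a vertex of a different cell), its arcs are all boundary arcs of $G$ (arcs whose endpoints lie in different cells) with their original weights, together with, for every cell $c$ and every ordered pair $(u,v)$ of boundary vertices of $c$, a clique arc $(u,v)$ whose weight equals the length of a shortest $u$–$v$ path in $G$ using only arcs with both endpoints in $c$ (omitted if no such path exists). Let $S\subseteq V$ be a set of landmarks and, for $u,v\in V$, let $\pi(u,v)=\max_{L\in S}\max\{d(u,L)-d(v,L),\, d(L,v)-d(L,u)\}$, where $d$ denotes shortest-path distance in $G$ (all assumed finite). For $s,t\in V$, let $G_{s,t}$ be the graph consisting of $H$ together with all vertices and arcs of $G$ lying inside the cell $c(s)$ containing $s$ and inside the cell $c(t)$ containing $t$. Then the SALT-p2p algorithm, i.e. the ALT algorithm (A* search using the landmark lower bounds $\pi(\cdot,t)$ as potential, in its unidirectional form, or in its bidirectional form with the average potentials $p_f(v)=(\pi(v,t)-\pi(s,v))/2$ for the forward and $p_r(v)=-p_f(v)$ for the backward search) run from $s$ to $t$ on $G_{s,t}$, returns the shortest-path distance $d(s,t)$ in $G$.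
   Context: The ALT algorithm is the A* algorithm with potentials derived from precomputed landmark distances via the triangle inequality; bidirectional ALT runs a forward search from $s$ and a backward search from $t$ on the reverse graph with the stated average potentials and the usual stopping criterion. *)

theory Defs
  imports "Graph_Theory.Digraph_Component" "Graph_Theory.Shortest_Path" "HOL-Library.Disjoint_Sets"
begin

section \<open>Overlay graphs\<close>

abbreviation sp_dist :: "('a, 'b) pre_digraph \<Rightarrow> 'b weight_fun \<Rightarrow> 'a \<Rightarrow> 'a \<Rightarrow> ereal" where
  "sp_dist G w u v \<equiv> wf_digraph.\<mu> G w u v"

definition cell :: "'a set set \<Rightarrow> 'a \<Rightarrow> 'a set" where
  "cell C v = (THE c. c \<in> C \<and> v \<in> c)"

definition boundary_arcs :: "('a, 'b) pre_digraph \<Rightarrow> 'a set set \<Rightarrow> 'b set" where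
  "boundary_arcs G C = {e \<in> arcs G. cell C (tail G e) \<noteq> cell C (head G e)}"

definition boundary_verts :: "('a, 'b) pre_digraph \<Rightarrow> 'a set set \<Rightarrow> 'a set" where
  "boundary_verts G C = {v \<in> verts G. \<exists>e \<in> boundary_arcs G C. tail G e = v \<or> head G e = v}"

text \<open>
  Arcs of the overlay graph: \<open>Inl e\<close> is an arc \<open>e\<close> of the original graph,
  \<open>Inr (u, v)\<close> is the clique arc from \<open>u\<close> to \<open>v\<close>. An original arc inside a cell and a
  clique arc with the same ends are therefore parallel arcs. The pairs \<open>(u, u)\<close> are
  included and give loops of length 0.
\<close>

definition clique_arcs ::
  "('a, 'b) pre_digraph \<Rightarrow> 'b weight_fun \<Rightarrow> 'a set set \<Rightarrow> ('a \<times> 'a) set" where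
  "clique_arcs G w C =
    {(u, v). \<exists>c \<in> C. u \<in> boundary_verts G C \<inter> c \<and> v \<in> boundary_verts G C \<inter> c \<and>
      sp_dist (G \<restriction> c) w u v \<noteq> \<infinity>}"

definition overlay ::
  "('a, 'b) pre_digraph \<Rightarrow> 'b weight_fun \<Rightarrow> 'a set set \<Rightarrow> ('a, 'b + 'a \<times> 'a) pre_digraph" where
  "overlay G w C =
    \<lparr> verts = boundary_verts G C,
      arcs = Inl ` boundary_arcs G C \<union> Inr ` clique_arcs G w C,
      tail = case_sum (tail G) fst,
      head = case_sum (head G) snd \<rparr>"

definition overlay_weight ::
  "('a, 'b) pre_digraph \<Rightarrow> 'b weight_fun \<Rightarrow> 'a set set \<Rightarrow> ('b + 'a \<times> 'a) weight_fun" where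
  "overlay_weight G w C =
    case_sum w (\<lambda>(u, v). real_of_ereal (sp_dist (G \<restriction> cell C u) w u v))"

definition query_graph ::
  "('a, 'b) pre_digraph \<Rightarrow> 'b weight_fun \<Rightarrow> 'a set set \<Rightarrow> 'a \<Rightarrow> 'a \<Rightarrow>
    ('a, 'b + 'a \<times> 'a) pre_digraph" where
  "query_graph G w C s t = (let H = overlay G w C in
    H\<lparr> verts := verts H \<union> cell C s \<union> cell C t,
      arcs := arcs H \<union> Inl ` arcs (G \<restriction> cell C s) \<union> Inl ` arcs (G \<restriction> cell C t) \<rparr>)"


section \<open>Landmark potentials\<close>

text \<open>
  For \<open>S = {}\<close> the maximum is an unspecified constant, so all differences of values of
  \<open>landmark_bound\<close> vanish and the searches below degenerate to Dijkstra's algorithm.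
\<close>

definition landmark_bound ::
  "('a, 'b) pre_digraph \<Rightarrow> 'b weight_fun \<Rightarrow> 'a set \<Rightarrow> 'a \<Rightarrow> 'a \<Rightarrow> real" where
  "landmark_bound G w S u v =
    (let d = (\<lambda>x y. real_of_ereal (sp_dist G w x y)) in
      MAX L\<in>S. max (d u L - d v L) (d L v - d L u))"

definition forward_potential ::
  "('a, 'b) pre_digraph \<Rightarrow> 'b weight_fun \<Rightarrow> 'a set \<Rightarrow> 'a \<Rightarrow> 'a \<Rightarrow> 'a \<Rightarrow> real" where
  "forward_potential G w S s t v = (landmark_bound G w S v t - landmark_bound G w S s v) / 2"


section \<open>A* search\<close>

text \<open>
  Algorithms are nondeterministic transition systems, since ties between minimal keys (and the
  alternation of the two searches in the bidirectional case) are left open.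
\<close>

datatype 'c config = Running 'c | Returned ereal

text \<open>Every maximal run from \<open>x\<close> is finite and ends by returning \<open>r\<close>.\<close>

definition always_returns :: "('c config \<Rightarrow> 'c config \<Rightarrow> bool) \<Rightarrow> 'c \<Rightarrow> ereal \<Rightarrow> bool" where
  "always_returns step x r \<longleftrightarrow>
    (\<nexists>f :: nat \<Rightarrow> 'c config. f 0 = Running x \<and> (\<forall>n. step (f n) (f (Suc n)))) \<and>
    (\<forall>y. step\<^sup>*\<^sup>* (Running x) y \<and> (\<nexists>z. step y z) \<longrightarrow> y = Returned r)"

text \<open>
  \<open>tdist\<close> holds the tentative distances (\<open>\<infinity>\<close> for unreached vertices), \<open>queue\<close> the vertices that
  are reached and still have to be scanned.
\<close>

record 'a search =
  tdist :: "'a \<Rightarrow> ereal"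
  queue :: "'a set"

definition init_search :: "'a \<Rightarrow> 'a search" where
  "init_search s = \<lparr> tdist = (\<lambda>v. if v = s then 0 else \<infinity>), queue = {s} \<rparr>"

definition key :: "('a \<Rightarrow> real) \<Rightarrow> 'a search \<Rightarrow> 'a \<Rightarrow> ereal" where
  "key p X v = tdist X v + ereal (p v)"

definition is_min :: "('a \<Rightarrow> real) \<Rightarrow> 'a search \<Rightarrow> 'a \<Rightarrow> bool" where
  "is_min p X v \<longleftrightarrow> is_arg_min (key p X) (\<lambda>u. u \<in> queue X) v"

text \<open>
  Removing \<open>v\<close> from the queue and relaxing its outgoing arcs; every vertex whose tentative
  distance decreases is (re)inserted into the queue.
\<close>

definition scan :: "('a, 'b) pre_digraph \<Rightarrow> 'b weight_fun \<Rightarrow> 'a \<Rightarrow> 'a search \<Rightarrow> 'a search" where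
  "scan G w v X =
    (let d' = (\<lambda>u. min (tdist X u)
                    (INF e\<in>{e \<in> out_arcs G v. head G e = u}. tdist X v + ereal (w e)))
     in \<lparr> tdist = d', queue = (queue X - {v}) \<union> {u. d' u < tdist X u} \<rparr>)"

inductive astar_step ::
  "('a, 'b) pre_digraph \<Rightarrow> 'b weight_fun \<Rightarrow> ('a \<Rightarrow> real) \<Rightarrow> 'a \<Rightarrow>
    'a search config \<Rightarrow> 'a search config \<Rightarrow> bool"
  for G w p t where
  exhausted: "queue X = {} \<Longrightarrow> astar_step G w p t (Running X) (Returned \<infinity>)"
| target: "is_min p X t \<Longrightarrow> astar_step G w p t (Running X) (Returned (tdist X t))"
| expand: "is_min p X v \<Longrightarrow> v \<noteq> t \<Longrightarrow> astar_step G w p t (Running X) (Running (scan G w v X))"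


section \<open>Bidirectional A* search\<close>

definition reverse_digraph :: "('a, 'b) pre_digraph \<Rightarrow> ('a, 'b) pre_digraph" where
  "reverse_digraph G = G\<lparr> tail := head G, head := tail G \<rparr>"

definition top_key :: "('a \<Rightarrow> real) \<Rightarrow> 'a search \<Rightarrow> ereal" where
  "top_key p X = (INF v\<in>queue X. key p X v)"

text \<open>
  Length of the shortest path found when \<open>v\<close> is scanned by search \<open>X\<close>: an arc from \<open>v\<close> joined with
  the tentative paths of both searches.
\<close>

definition meet ::
  "('a, 'b) pre_digraph \<Rightarrow> 'b weight_fun \<Rightarrow> 'a \<Rightarrow> 'a search \<Rightarrow> 'a search \<Rightarrow> ereal" where
  "meet G w v X Y = (INF e\<in>out_arcs G v. tdist X v + ereal (w e) + tdist Y (head G e))"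

text \<open>
  A state consists of the forward search, the backward search and the length \<open>m\<close> of the best
  path found so far. The stopping criterion is that of bidirectional Dijkstra search for the
  reduced arc lengths \<open>w (u, v) - pf u + pf v\<close>. There the minimal queue entries are
  \<open>top_key pf F - pf s\<close> and \<open>top_key pr B - pr t\<close> and the best path has length
  \<open>m - pf s + pf t\<close>, so that for \<open>pr = - pf\<close> the criterion becomes
  \<open>m \<le> top_key pf F + top_key pr B\<close>. Empty queues have top key \<open>\<infinity>\<close> and hence also stop the
  search.
\<close>

type_synonym 'a bisearch = "'a search \<times> 'a search \<times> ereal"

definition init_bisearch :: "'a \<Rightarrow> 'a \<Rightarrow> 'a bisearch" where
  "init_bisearch s t = (init_search s, init_search t, if s = t then 0 else \<infinity>)"

inductive biastar_step ::
  "('a, 'b) pre_digraph \<Rightarrow> 'b weight_fun \<Rightarrow> ('a \<Rightarrow> real) \<Rightarrow> ('a \<Rightarrow> real) \<Rightarrow>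
    'a bisearch config \<Rightarrow> 'a bisearch config \<Rightarrow> bool"
  for G w pf pr where
  stop: "m \<le> top_key pf F + top_key pr B \<Longrightarrow>
    biastar_step G w pf pr (Running (F, B, m)) (Returned m)"
| forward: "top_key pf F + top_key pr B < m \<Longrightarrow> is_min pf F v \<Longrightarrow>
    biastar_step G w pf pr (Running (F, B, m))
      (Running (scan G w v F, B, min m (meet G w v F B)))"
| backward: "top_key pf F + top_key pr B < m \<Longrightarrow> is_min pr B v \<Longrightarrow>
    biastar_step G w pf pr (Running (F, B, m))
      (Running (F, scan (reverse_digraph G) w v B, min m (meet (reverse_digraph G) w v B F)))"


section \<open>SALT-p2p\<close>

definition salt_p2p_step ::
  "('a, 'b) pre_digraph \<Rightarrow> 'b weight_fun \<Rightarrow> 'a set set \<Rightarrow> 'a set \<Rightarrow> 'a \<Rightarrow> 'a \<Rightarrow>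
    'a search config \<Rightarrow> 'a search config \<Rightarrow> bool" where
  "salt_p2p_step G w C S s t =
    astar_step (query_graph G w C s t) (overlay_weight G w C)
      (\<lambda>v. landmark_bound G w S v t) t"

definition bi_salt_p2p_step ::
  "('a, 'b) pre_digraph \<Rightarrow> 'b weight_fun \<Rightarrow> 'a set set \<Rightarrow> 'a set \<Rightarrow> 'a \<Rightarrow> 'a \<Rightarrow>
    'a bisearch config \<Rightarrow> 'a bisearch config \<Rightarrow> bool" where
  "bi_salt_p2p_step G w C S s t =
    biastar_step (query_graph G w C s t) (overlay_weight G w C)
      (forward_potential G w S s t) (\<lambda>v. - forward_potential G w S s t v)"

end

theory Submission
  imports Defs
begin

text \<open>
  Every arc of the query graph is at least as long as the distance of its ends in \<open>G\<close>. Hence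
  distances in the query graph are not shorter than in \<open>G\<close>, and the landmark potentials, which
  are 1-Lipschitz for the distance of \<open>G\<close>, stay consistent. Conversely a walk of \<open>G\<close> is cut at
  its boundary arcs: the pieces in intermediate cells are replaced by clique arcs, and the first
  and last pieces lie in the cells of \<open>s\<close> and \<open>t\<close>, which the query graph contains completely.

  For a consistent potential, keys never decrease along a search, so every vertex is scanned at
  most once and the runs are finite. At each moment a walk from \<open>s\<close> to \<open>t\<close> either is
  bounded below by the tentative distance of \<open>t\<close>, or meets the queue at a vertex whose tentative
  distance is at most the length of the corresponding prefix. For the bidirectional search the
  invariant \<open>m \<le> tdist F v + tdist B v\<close> for all \<open>v\<close> does the rest: a walk either has length at
  least \<open>m\<close>, or it meets the forward queue and, later, the backward queue, and then
  consistency bounds its length below by the sum of the two top keys.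
\<close>

text \<open>The decreasing measure \<open>f\<close> excludes infinite runs. By
  \<open>progress\<close> a \<open>Running\<close> state is never stuck, so a maximal run ends in a
  \<open>Returned\<close> state, whose value is fixed by \<open>ret\<close>.\<close>

lemma always_returnsI:
  fixes f :: "'c \<Rightarrow> nat"
  assumes "Inv x"
    and run: "\<And>x y. Inv x \<Longrightarrow> step (Running x) (Running y) \<Longrightarrow> Inv y \<and> f y < f x"
    and ret: "\<And>x q. Inv x \<Longrightarrow> step (Running x) (Returned q) \<Longrightarrow> q = r"
    and progress: "\<And>x. Inv x \<Longrightarrow> \<exists>z. step (Running x) z"
    and final: "\<And>q z. \<not> step (Returned q) z"
  shows "always_returns step x r"
proof -
  have "\<nexists>g. g (0::nat) = Running x \<and> (\<forall>n. step (g n) (g (Suc n)))"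
  proof
    assume "\<exists>g. g (0::nat) = Running x \<and> (\<forall>n. step (g n) (g (Suc n)))"
    then obtain g where g0: "g (0::nat) = Running x" and gS: "\<And>n. step (g n) (g (Suc n))"
      by blast
    \<comment> \<open>The measure serves as a budget: after \<open>n\<close> steps at least
      \<open>n\<close> units of \<open>f x\<close> are spent, which fails for
      \<open>n = Suc (f x)\<close>.\<close>
    have "\<exists>y. g n = Running y \<and> Inv y \<and> f y + n \<le> f x" for n
    proof (induction n)
      case 0
      show ?case using g0 \<open>Inv x\<close> by simp
    next
      case (Suc n)
      then obtain y where y: "g n = Running y" "Inv y" "f y + n \<le> f x" by blast
      obtain z where z: "g (Suc n) = Running z"
        using gS[of "Suc n"] final by (cases "g (Suc n)") auto
      have "step (Running y) (Running z)" using gS[of n] y z by simp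
      then show ?case using run[OF y(2)] y z by force
    qed
    from this[of "Suc (f x)"] show False by auto
  qed
  moreover have "(\<exists>z. y = Running z \<and> Inv z) \<or> y = Returned r" if "step\<^sup>*\<^sup>* (Running x) y" for y
    using that
  proof induction
    case base
    then show ?case using \<open>Inv x\<close> by simp
  next
    case (step y z)
    then obtain y' where "y = Running y'" "Inv y'" using final by blast
    then show ?case using step run ret by (cases z) auto
  qed
  ultimately show ?thesis unfolding always_returns_def using progress by blast
qed

section \<open>Invariants of a single search\<close>

text \<open>Equivalent to nonnegativity of the reduced arc lengths
  \<open>w e - p (tail G e) + p (head G e)\<close>, for which A* is Dijkstra's algorithm.\<close>

definition consistent :: "('a, 'b) pre_digraph \<Rightarrow> 'b weight_fun \<Rightarrow> ('a \<Rightarrow> real) \<Rightarrow> bool" where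
  "consistent G w p \<longleftrightarrow> (\<forall>e\<in>arcs G. p (tail G e) \<le> w e + p (head G e))"

text \<open>Not permanent by definition, since \<open>scan\<close> may reinsert a vertex; under a
  consistent potential the set only grows.\<close>

definition settled :: "'a search \<Rightarrow> 'a set" where
  "settled X = {v. tdist X v < \<infinity> \<and> v \<notin> queue X}"

text \<open>Finite tentative distances are lengths of actual walks, and arcs leaving settled
  vertices are relaxed. The last clause, ordering keys of settled vertices before those of queued
  ones, is what prevents reinsertion. The graph is an explicit parameter because the backward search
  uses the same invariant on the reversed graph.\<close>

definition search_inv ::
  "('a, 'b) pre_digraph \<Rightarrow> 'b weight_fun \<Rightarrow> ('a \<Rightarrow> real) \<Rightarrow> 'a \<Rightarrow> 'a search \<Rightarrow> bool" where
  "search_inv G w p s X \<longleftrightarrow>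
    tdist X s \<le> 0 \<and>
    (\<forall>v. tdist X v < \<infinity> \<longrightarrow>
      (\<exists>q. pre_digraph.awalk G s q v \<and> tdist X v = ereal (wf_digraph.awalk_cost w q))) \<and>
    (\<forall>v\<in>queue X. tdist X v < \<infinity>) \<and>
    (\<forall>e\<in>arcs G. tail G e \<in> settled X \<longrightarrow>
      tdist X (head G e) \<le> tdist X (tail G e) + ereal (w e)) \<and>
    (\<forall>u\<in>settled X. \<forall>v\<in>queue X. key p X u \<le> key p X v)"

lemma search_invD:
  assumes "search_inv G w p s X"
  shows "tdist X s \<le> 0"
    and "tdist X v < \<infinity> \<Longrightarrow>
      \<exists>q. pre_digraph.awalk G s q v \<and> tdist X v = ereal (wf_digraph.awalk_cost w q)"
    and "v \<in> queue X \<Longrightarrow> tdist X v < \<infinity>"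
    and "e \<in> arcs G \<Longrightarrow> tail G e \<in> settled X \<Longrightarrow>
      tdist X (head G e) \<le> tdist X (tail G e) + ereal (w e)"
    and "u \<in> settled X \<Longrightarrow> v \<in> queue X \<Longrightarrow> key p X u \<le> key p X v"
  using assms unfolding search_inv_def by blast+

lemma is_minD:
  assumes "is_min p X v"
  shows "v \<in> queue X" and "u \<in> queue X \<Longrightarrow> key p X v \<le> key p X u"
  using assms unfolding is_min_def by (auto simp: is_arg_min_linorder)

lemma tdist_scan_le: "tdist (scan G w v X) u \<le> tdist X u"
  by (simp add: scan_def)

lemma tdist_scan_head:
  assumes "e \<in> arcs G" "tail G e = v"
  shows "tdist (scan G w v X) (head G e) \<le> tdist X v + ereal (w e)"
  using assms by (auto simp: scan_def intro!: min.coboundedI2 INF_lower)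

lemma queue_scan:
  "queue (scan G w v X) = (queue X - {v}) \<union> {u. tdist (scan G w v X) u < tdist X u}"
  by (simp add: scan_def Let_def)

context fin_digraph
begin

text \<open>A strict decrease forces at least one arc from \<open>v\<close> to \<open>u\<close>, as
  an empty infimum is \<infinity>; the infimum over the finitely many parallel arcs is then
  attained.\<close>

lemma tdist_scan_lessE:
  assumes "tdist (scan G w v X) u < tdist X u"
  obtains e where "e \<in> arcs G" "tail G e = v" "head G e = u"
    "tdist (scan G w v X) u = tdist X v + ereal (w e)"
proof -
  let ?E = "{e \<in> out_arcs G v. head G e = u}"
  let ?I = "INF e\<in>?E. tdist X v + ereal (w e)"
  have sc: "tdist (scan G w v X) u = min (tdist X u) ?I"
    by (simp add: scan_def)
  with assms have eq: "tdist (scan G w v X) u = ?I" and less: "?I < tdist X u"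
    by (auto simp: min_def split: if_splits)
  have "?E \<noteq> {}"
  proof
    assume "?E = {}"
    then have "?I = top" by (simp only: image_empty Inf_empty)
    with less show False by (simp add: top_ereal_def)
  qed
  moreover have "finite ?E" by auto
  ultimately have "?I \<in> (\<lambda>e. tdist X v + ereal (w e)) ` ?E"
    by (intro finite_INF_in) auto
  then show thesis using that eq by auto
qed

text \<open>By consistency an improved key is at least the key of \<open>v\<close>, while keys of
  settled vertices are at most that. So neither \<open>v\<close> nor a settled vertex can improve,
  and the settled set gains exactly \<open>v\<close>.\<close>

lemma search_inv_scan:
  assumes con: "consistent G w p" and inv: "search_inv G w p s X" and min: "is_min p X v"
  shows "search_inv G w p s (scan G w v X)"
    and "settled (scan G w v X) = insert v (settled X)"
proof -
  define Y where "Y = scan G w v X"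
  note I = search_invD[OF inv]
  note v = is_minD[OF min]
  obtain q where q: "awalk s q v" "tdist X v = ereal (awalk_cost w q)"
    using I(2)[OF I(3)[OF v(1)]] by blast
  have new: "\<exists>e. e \<in> arcs G \<and> tail G e = v \<and> head G e = u \<and>
      tdist Y u = ereal (awalk_cost w q + w e)" if "tdist Y u < tdist X u" for u
    using that q(2) unfolding Y_def by (elim tdist_scan_lessE) auto
  have key_new: "key p X v \<le> key p Y u" if "tdist Y u < tdist X u" for u
  proof -
    from new[OF that] obtain e where e: "e \<in> arcs G" "tail G e = v" "head G e = u"
      "tdist Y u = ereal (awalk_cost w q + w e)" by blast
    have "p v \<le> w e + p u" using con e unfolding consistent_def by blast
    then show ?thesis using e q by (simp add: key_def)
  qed
  \<comment> \<open>A vertex in the new queue either has just improved or was queued before, where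
    \<open>v\<close> is minimal.\<close>
  have key_v: "key p X v \<le> key p Y u" if "u \<in> queue Y" for u
  proof (cases "tdist Y u < tdist X u")
    case False
    then have "tdist Y u = tdist X u" "u \<in> queue X"
      using that tdist_scan_le[of G w v X u] queue_scan[of G w v X] unfolding Y_def by auto
    then show ?thesis using v(2)[of u] by (simp add: key_def)
  qed (rule key_new)
  have keep: "tdist Y u = tdist X u" if "u \<in> insert v (settled X)" for u
  proof (rule ccontr)
    assume "tdist Y u \<noteq> tdist X u"
    then have less: "tdist Y u < tdist X u"
      using tdist_scan_le[of G w v X u] unfolding Y_def by auto
    have "key p X u \<le> key p X v" using that I(5)[of u v] v(1) by auto
    also have "\<dots> \<le> key p Y u" by (rule key_new[OF less])
    finally have "key p X u \<le> key p Y u" .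
    moreover have "tdist X u < \<infinity>" using that q(2) by (auto simp: settled_def)
    then obtain a where "tdist X u = ereal a" using I(2) by blast
    ultimately show False using less new[OF less] by (auto simp: key_def)
  qed
  have settled: "settled Y = insert v (settled X)"
  proof (intro equalityI subsetI)
    fix u assume "u \<in> settled Y"
    then have "tdist Y u < \<infinity>" "u \<notin> queue X - {v}" "\<not> tdist Y u < tdist X u"
      by (auto simp: settled_def Y_def queue_scan)
    then show "u \<in> insert v (settled X)"
      using tdist_scan_le[of G w v X u] by (auto simp: settled_def Y_def)
  next
    fix u assume u: "u \<in> insert v (settled X)"
    then show "u \<in> settled Y"
      using keep[OF u] q(2) by (auto simp: settled_def Y_def queue_scan)
  qed
  then show "settled (scan G w v X) = insert v (settled X)" by (simp add: Y_def)
  have "tdist Y s \<le> 0"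
    using I(1) tdist_scan_le[of G w v X s] by (simp add: Y_def)
  moreover have "\<exists>q. awalk s q u \<and> tdist Y u = ereal (awalk_cost w q)" if "tdist Y u < \<infinity>" for u
  proof (cases "tdist Y u < tdist X u")
    case True
    from new[OF this] obtain e where e: "e \<in> arcs G" "tail G e = v" "head G e = u"
      "tdist Y u = ereal (awalk_cost w q + w e)" by blast
    then have "awalk v [e] u" by (auto simp: awalk_simps)
    then have "awalk s (q @ [e]) u" using q(1) by (rule awalk_appendI[rotated])
    then show ?thesis using e by (intro exI[of _ "q @ [e]"]) simp
  next
    case False
    then have "tdist Y u = tdist X u"
      using tdist_scan_le[of G w v X u] by (simp add: Y_def)
    then show ?thesis using I(2)[of u] that by simp
  qed
  moreover have "tdist Y u < \<infinity>" if "u \<in> queue Y" for u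
    using that I(3)[of u] tdist_scan_le[of G w v X u]
    by (auto simp: Y_def queue_scan intro: le_less_trans less_le_trans)
  moreover have "tdist Y (head G e) \<le> tdist Y (tail G e) + ereal (w e)"
    if "e \<in> arcs G" "tail G e \<in> settled Y" for e
  \<comment> \<open>Arcs out of \<open>v\<close> have just been relaxed. For the others the tail
    keeps its distance and the head can only get closer.\<close>
  proof (cases "tail G e = v")
    case True
    then show ?thesis
      using tdist_scan_head[OF that(1) True, of w X] keep[of v] by (simp add: Y_def)
  next
    case False
    then have t: "tail G e \<in> settled X" using that settled by simp
    then have "tdist X (head G e) \<le> tdist Y (tail G e) + ereal (w e)"
      using I(4)[OF that(1)] keep[of "tail G e"] by simp
    then show ?thesis
      using tdist_scan_le[of G w v X "head G e"] unfolding Y_def by (rule order_trans[rotated])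
  qed
  moreover have "key p Y u \<le> key p Y x" if "u \<in> settled Y" "x \<in> queue Y" for u x
  proof -
    have u: "u \<in> insert v (settled X)" using that settled by simp
    have "key p Y u = key p X u" using keep[OF u] by (simp add: key_def)
    also have "\<dots> \<le> key p X v" using u I(5)[of u v] v(1) by auto
    also have "\<dots> \<le> key p Y x" by (rule key_v[OF that(2)])
    finally show ?thesis .
  qed
  ultimately show "search_inv G w p s (scan G w v X)"
    unfolding search_inv_def Y_def[symmetric] by blast
qed

lemma search_inv_init:
  assumes "s \<in> verts G"
  shows "search_inv G w p s (init_search s)"
  unfolding search_inv_def using assms
  by (auto simp: init_search_def settled_def awalk_Nil_iff intro!: exI[of _ "[]"])

lemma search_inv_in_verts:
  assumes "search_inv G w p s X" "tdist X v < \<infinity>"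
  shows "v \<in> verts G"
  using search_invD(2)[OF assms] by auto

lemma search_inv_queue:
  assumes "search_inv G w p s X"
  shows "queue X \<subseteq> verts G" "finite (queue X)"
proof -
  show "queue X \<subseteq> verts G"
    using search_invD(3)[OF assms] search_inv_in_verts[OF assms] by blast
  then show "finite (queue X)" using finite_verts by (rule finite_subset)
qed

lemma search_inv_is_min_ex:
  assumes "search_inv G w p s X" "queue X \<noteq> {}"
  obtains v where "is_min p X v"
  using ex_is_arg_min_if_finite[of "queue X" "key p X"] search_inv_queue[OF assms(1)] assms(2) that
  unfolding is_min_def by blast

text \<open>A queued vertex is unsettled and its scan settles it, so every vertex is scanned at most
  once.\<close>

lemma scan_measure_less:
  assumes "consistent G w p" "search_inv G w p s X" "is_min p X v"
  shows "card (verts G - settled (scan G w v X)) < card (verts G - settled X)"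
proof -
  have v: "v \<in> queue X" by (rule is_minD[OF assms(3)])
  then have "v \<in> verts G - settled X"
    using search_inv_queue[OF assms(2)] by (auto simp: settled_def)
  then have "verts G - settled (scan G w v X) \<subset> verts G - settled X"
    unfolding search_inv_scan(2)[OF assms] by blast
  then show ?thesis by (intro psubset_card_mono) auto
qed

lemma search_inv_mu_le:
  assumes "search_inv G w p s X"
  shows "\<mu> w s v \<le> tdist X v"
proof (cases "tdist X v < \<infinity>")
  case True
  then show ?thesis using search_invD(2)[OF assms True] min_cost_le_walk_cost by metis
qed simp

text \<open>As long as the walk visits settled vertices, relaxed arcs carry the bound along it; the
  first reached vertex that is not settled is queued. The offset \<open>c\<close> accumulates the
  cost of the prefix in the induction.\<close>

lemma search_inv_walk:
  assumes inv: "search_inv G w p s X" and "awalk x q y" "tdist X x \<le> ereal c"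
  shows "tdist X y \<le> ereal (c + awalk_cost w q) \<or>
    (\<exists>q1 q2 z. q = q1 @ q2 \<and> awalk x q1 z \<and> awalk z q2 y \<and> z \<in> queue X \<and>
      tdist X z \<le> ereal (c + awalk_cost w q1))"
  using assms(2,3)
proof (induction q arbitrary: x c)
  case Nil
  then show ?case by (simp add: awalk_Nil_iff)
next
  case (Cons e q)
  then have e: "e \<in> arcs G" "x = tail G e" "awalk (head G e) q y"
    by (auto simp: awalk_Cons_iff)
  show ?case
  proof (cases "x \<in> queue X")
    case True
    then show ?thesis
      using Cons.prems
      by (intro disjI2 exI[of _ "[]"] exI[of _ "e # q"] exI[of _ x]) (auto simp: awalk_Nil_iff)
  next
    case False
    then have "x \<in> settled X" using Cons.prems(2) by (auto simp: settled_def)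
    then have "tdist X (head G e) \<le> tdist X x + ereal (w e)"
      using search_invD(4)[OF inv e(1)] e(2) by simp
    also have "\<dots> \<le> ereal (c + w e)"
      using Cons.prems(2) by (metis add_right_mono plus_ereal.simps(1))
    finally have "tdist X (head G e) \<le> ereal (c + w e)" .
    from Cons.IH[OF e(3) this] show ?thesis
    proof (elim disjE exE conjE)
      fix q1 q2 z
      assume "q = q1 @ q2" "awalk (head G e) q1 z" "awalk z q2 y" "z \<in> queue X"
        "tdist X z \<le> ereal (c + w e + awalk_cost w q1)"
      then show ?thesis
        using e by (intro disjI2 exI[of _ "e # q1"] exI[of _ q2] exI[of _ z])
          (auto simp: awalk_Cons_iff add.assoc)
    qed (simp add: add.assoc)
  qed
qed

text \<open>The arcwise inequalities telescope along the walk.\<close>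

lemma consistent_walk:
  assumes "consistent G w p" "awalk x q y"
  shows "p x \<le> awalk_cost w q + p y"
  using assms(2)
proof (induction q arbitrary: x)
  case (Cons e q)
  then have "e \<in> arcs G" "x = tail G e" "p (head G e) \<le> awalk_cost w q + p y"
    by (auto simp: awalk_Cons_iff)
  then show ?case using assms(1) unfolding consistent_def by fastforce
qed (simp add: awalk_Nil_iff)

section \<open>Unidirectional search\<close>

lemma target_tdist:
  assumes con: "consistent G w p" and inv: "search_inv G w p s X" and min: "is_min p X t"
  shows "tdist X t = \<mu> w s t"
proof (rule antisym)
  note I = search_invD[OF inv]
  obtain a where a: "tdist X t = ereal a"
    using I(2)[OF I(3)[OF is_minD(1)[OF min]]] by blast
  show "tdist X t \<le> \<mu> w s t"
    unfolding \<mu>_def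
  proof (rule INF_greatest, clarify)
    fix q assume q: "awalk s q t"
    have "tdist X s \<le> ereal 0" using I(1) by (simp add: zero_ereal_def)
    from search_inv_walk[OF inv q this] show "tdist X t \<le> ereal (awalk_cost w q)"
    proof (elim disjE exE conjE)
      fix q1 q2 z
      assume z: "q = q1 @ q2" "awalk s q1 z" "awalk z q2 t" "z \<in> queue X"
        "tdist X z \<le> ereal (0 + awalk_cost w q1)"
      obtain b where b: "tdist X z = ereal b" using I(2)[OF I(3)[OF z(4)]] by blast
      have "key p X t \<le> key p X z" by (rule is_minD(2)[OF min z(4)])
      \<comment> \<open>Minimality of \<open>t\<close> compares the keys at \<open>t\<close> and
        \<open>z\<close>; consistency on the rest \<open>q2\<close> bounds \<open>p z - p t\<close>,
        so the potentials cancel.\<close>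
      then have "a + p t \<le> b + p z" by (simp add: key_def a b)
      moreover have "p z \<le> awalk_cost w q2 + p t" by (rule consistent_walk[OF con z(3)])
      ultimately show ?thesis using z b a by simp
    qed simp
  qed
qed (rule search_inv_mu_le[OF inv])

text \<open>The invariant also keeps \<open>t\<close> unsettled, since \<open>t\<close> is returned
  instead of being scanned. This is what makes the answer \<infinity> correct when the queue runs
  empty.\<close>

lemma astar_returns:
  assumes con: "consistent G w p" and s: "s \<in> verts G"
  shows "always_returns (astar_step G w p t) (init_search s) (\<mu> w s t)"
proof (rule always_returnsI[where
      Inv = "\<lambda>X. search_inv G w p s X \<and> t \<notin> settled X" and
      f = "\<lambda>X. card (verts G - settled X)"])
  show "search_inv G w p s (init_search s) \<and> t \<notin> settled (init_search s)"
    using search_inv_init[OF s] by (auto simp: init_search_def settled_def)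
next
  fix X Y assume X: "search_inv G w p s X \<and> t \<notin> settled X"
    and "astar_step G w p t (Running X) (Running Y)"
  then obtain v where "is_min p X v" "v \<noteq> t" "Y = scan G w v X"
    by (auto elim: astar_step.cases)
  then show "(search_inv G w p s Y \<and> t \<notin> settled Y) \<and>
      card (verts G - settled Y) < card (verts G - settled X)"
    using X search_inv_scan[OF con, of s X v] scan_measure_less[OF con, of s X v] by auto
next
  fix X r assume X: "search_inv G w p s X \<and> t \<notin> settled X"
    and "astar_step G w p t (Running X) (Returned r)"
  then consider "queue X = {}" "r = \<infinity>" | "is_min p X t" "r = tdist X t"
    by (auto elim: astar_step.cases)
  then show "r = \<mu> w s t"
  proof cases
    case 1
    \<comment> \<open>With an empty queue a walk to \<open>t\<close> would make \<open>t\<close>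
      reached and hence settled. Without walks the infimum defining the distance is
      \<infinity>.\<close>
    have "\<not> awalk s q t" for q
    proof
      assume q: "awalk s q t"
      have "tdist X s \<le> ereal 0" using X by (simp add: search_inv_def zero_ereal_def)
      then have "tdist X t < \<infinity>"
        using search_inv_walk[OF conjunct1[OF X] q] 1 by auto
      then show False using X 1 by (auto simp: settled_def)
    qed
    then show ?thesis using 1 by (simp add: \<mu>_def top_ereal_def)
  next
    case 2
    then show ?thesis using target_tdist[OF con] X by blast
  qed
next
  fix X assume X: "search_inv G w p s X \<and> t \<notin> settled X"
  show "\<exists>z. astar_step G w p t (Running X) z"
  proof (cases "queue X = {}")
    case False
    then obtain v where "is_min p X v" using search_inv_is_min_ex X by blast
    then show ?thesis by (cases "v = t") (auto intro: astar_step.intros)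
  qed (auto intro: astar_step.intros)
next
  show "\<not> astar_step G w p t (Returned q) z" for q z
    by (auto elim: astar_step.cases)
qed

end

section \<open>Bidirectional search\<close>

lemma reverse_digraph_simps [simp]:
  "verts (reverse_digraph G) = verts G" "arcs (reverse_digraph G) = arcs G"
  "tail (reverse_digraph G) = head G" "head (reverse_digraph G) = tail G"
  "reverse_digraph (reverse_digraph G) = G"
  by (simp_all add: reverse_digraph_def)

text \<open>Swapping the ends of an arc and negating the potential leaves its reduced length
  unchanged, so both searches use the same reduced lengths.\<close>

lemma consistent_reverse_digraph:
  assumes "consistent G w p"
  shows "consistent (reverse_digraph G) w (\<lambda>v. - p v)"
  using assms by (auto simp: consistent_def algebra_simps)

lemma (in wf_digraph) wf_digraph_reverse: "wf_digraph (reverse_digraph G)"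
  by unfold_locales auto

lemma (in fin_digraph) fin_digraph_reverse: "fin_digraph (reverse_digraph G)"
  by unfold_locales auto

lemma (in wf_digraph) awalk_rev:
  assumes "awalk u q v"
  shows "pre_digraph.awalk (reverse_digraph G) v (rev q) u"
proof -
  interpret R: wf_digraph "reverse_digraph G" by (rule wf_digraph_reverse)
  show ?thesis using assms
  proof (induction q arbitrary: u)
    case Nil
    then show ?case by (auto simp: awalk_Nil_iff R.awalk_Nil_iff)
  next
    case (Cons e q)
    then have "e \<in> arcs G" "u = tail G e" "R.awalk v (rev q) (head G e)"
      by (auto simp: awalk_Cons_iff)
    moreover from this have "R.awalk (head G e) [e] u"
      by (simp add: R.awalk_simps)
    ultimately show ?case using R.awalk_appendI by simp
  qed
qed

lemma (in wf_digraph) awalk_reverse_iff: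
  "pre_digraph.awalk (reverse_digraph G) u q v \<longleftrightarrow> awalk v (rev q) u"
  using awalk_rev[of v "rev q" u] wf_digraph.awalk_rev[OF wf_digraph_reverse, of u q v] by auto

lemma (in wf_digraph) awalk_cost_rev [simp]: "awalk_cost w (rev q) = awalk_cost w q"
  by (induction q) auto

lemma (in wf_digraph) mu_reverse: "wf_digraph.\<mu> (reverse_digraph G) w u v = \<mu> w v u"
proof -
  interpret R: wf_digraph "reverse_digraph G" by (rule wf_digraph_reverse)
  have walks: "{q. R.awalk u q v} = rev ` {q. awalk v q u}"
    unfolding awalk_reverse_iff by (auto simp: image_iff) (metis rev_rev_ident)
  show ?thesis unfolding \<mu>_def R.\<mu>_def walks image_image by simp
qed

text \<open>The backward search is a forward search from \<open>t\<close> in the reversed graph with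
  negated potential. The last two clauses bound \<open>m\<close> from both sides: it accounts for
  every vertex reached by both searches, yet never falls below the distance.\<close>

fun bisearch_inv ::
  "('a, 'b) pre_digraph \<Rightarrow> 'b weight_fun \<Rightarrow> ('a \<Rightarrow> real) \<Rightarrow> 'a \<Rightarrow> 'a \<Rightarrow> 'a bisearch \<Rightarrow> bool" where
  "bisearch_inv G w p s t (F, B, m) \<longleftrightarrow>
    search_inv G w p s F \<and> search_inv (reverse_digraph G) w (\<lambda>v. - p v) t B \<and>
    (\<forall>v. m \<le> tdist F v + tdist B v) \<and> sp_dist G w s t \<le> m"

declare bisearch_inv.simps [simp del]

context fin_digraph
begin

text \<open>This symmetry reduces backward steps to forward steps.\<close>

lemma bisearch_inv_reverse:
  "bisearch_inv (reverse_digraph G) w (\<lambda>v. - p v) t s (B, F, m) \<longleftrightarrow> bisearch_inv G w p s t (F, B, m)"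
  by (auto simp: bisearch_inv.simps mu_reverse add.commute)

text \<open>A vertex improves only through an arc from \<open>v\<close>, and its new sum of
  distances is then a term of the infimum \<open>meet\<close>. Conversely, each finite term of
  \<open>meet\<close> is the length of a walk from \<open>s\<close> to \<open>t\<close>.\<close>

lemma bisearch_inv_forward:
  assumes con: "consistent G w p" and inv: "bisearch_inv G w p s t (F, B, m)" and min: "is_min p F v"
  shows "bisearch_inv G w p s t (scan G w v F, B, min m (meet G w v F B))"
proof -
  have F: "search_inv G w p s F" and B: "search_inv (reverse_digraph G) w (\<lambda>v. - p v) t B"
    and m: "\<And>v. m \<le> tdist F v + tdist B v" and mu: "\<mu> w s t \<le> m"
    using inv by (auto simp: bisearch_inv.simps)
  have "min m (meet G w v F B) \<le> tdist (scan G w v F) u + tdist B u" for u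
  proof (cases "tdist (scan G w v F) u < tdist F u")
    case True
    then obtain e where e: "e \<in> arcs G" "tail G e = v" "head G e = u"
      "tdist (scan G w v F) u = tdist F v + ereal (w e)" by (elim tdist_scan_lessE)
    then have "meet G w v F B \<le> tdist (scan G w v F) u + tdist B u"
      unfolding meet_def by (intro INF_lower2[of e]) auto
    then show ?thesis by (rule min.coboundedI2)
  next
    case False
    then have "tdist (scan G w v F) u = tdist F u"
      using tdist_scan_le[of G w v F u] by simp
    then show ?thesis using m[of u] by (simp add: min.coboundedI1)
  qed
  moreover have "\<mu> w s t \<le> meet G w v F B"
    unfolding meet_def
  proof (rule INF_greatest)
    fix e assume "e \<in> out_arcs G v"
    then have e: "e \<in> arcs G" "tail G e = v" by auto
    obtain q where q: "awalk s q v" "tdist F v = ereal (awalk_cost w q)"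
      using search_invD(2)[OF F search_invD(3)[OF F is_minD(1)[OF min]]] by blast
    show "\<mu> w s t \<le> tdist F v + ereal (w e) + tdist B (head G e)"
    \<comment> \<open>If the backward search has not reached the head, the term is \<infinity>;
      otherwise forward walk, arc and reversed backward walk are joined.\<close>
    proof (cases "tdist B (head G e) < \<infinity>")
      case True
      then obtain q' where q': "awalk (head G e) (rev q') t"
        "tdist B (head G e) = ereal (awalk_cost w q')"
        using search_invD(2)[OF B] unfolding awalk_reverse_iff by blast
      have "awalk v (e # rev q') t" using e q' by (simp add: awalk_Cons_iff)
      then have "awalk s (q @ e # rev q') t" using q(1) by (rule awalk_appendI[rotated])
      from min_cost_le_walk_cost[OF this, of w] show ?thesis
        by (simp add: q(2) q'(2) add.assoc)
    qed (simp add: q(2))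
  qed
  ultimately show ?thesis
    using search_inv_scan(1)[OF con F min] B mu by (auto simp: bisearch_inv.simps)
qed

lemma bisearch_inv_backward:
  assumes con: "consistent G w p" and inv: "bisearch_inv G w p s t (F, B, m)"
    and min: "is_min (\<lambda>v. - p v) B v"
  shows "bisearch_inv G w p s t
    (F, scan (reverse_digraph G) w v B, min m (meet (reverse_digraph G) w v B F))"
  unfolding bisearch_inv_reverse[symmetric]
  using inv unfolding bisearch_inv_reverse[symmetric]
  by (rule fin_digraph.bisearch_inv_forward[OF fin_digraph_reverse consistent_reverse_digraph[OF con] _ min])

lemma bisearch_inv_init:
  assumes "s \<in> verts G" "t \<in> verts G"
  shows "bisearch_inv G w p s t (init_bisearch s t)"
proof -
  \<comment> \<open>For \<open>s = t\<close> the initial value of \<open>m\<close> is 0, the length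
    of the empty walk.\<close>
  have "\<mu> w s s \<le> 0"
    using min_cost_le_walk_cost[of s "[]" s w] assms(1) by (simp add: awalk_Nil_iff zero_ereal_def)
  then show ?thesis
    using search_inv_init[OF assms(1)] fin_digraph.search_inv_init[OF fin_digraph_reverse, of t] assms
    by (auto simp: init_bisearch_def bisearch_inv.simps init_search_def)
qed

lemma stop_correct:
  assumes con: "consistent G w p" and inv: "bisearch_inv G w p s t (F, B, m)"
    and stop: "m \<le> top_key p F + top_key (\<lambda>v. - p v) B"
  shows "m = \<mu> w s t"
proof (rule antisym)
  have F: "search_inv G w p s F" and B: "search_inv (reverse_digraph G) w (\<lambda>v. - p v) t B"
    and m: "\<And>v. m \<le> tdist F v + tdist B v"
    using inv by (auto simp: bisearch_inv.simps)
  show "\<mu> w s t \<le> m" using inv by (simp add: bisearch_inv.simps)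
  show "m \<le> \<mu> w s t"
    unfolding \<mu>_def
  proof (rule INF_greatest, clarify)
    fix q assume q: "awalk s q t"
    have s0: "tdist F s \<le> ereal 0" and t0: "tdist B t \<le> ereal 0"
      using search_invD(1)[OF F] search_invD(1)[OF B] by (simp_all add: zero_ereal_def)
    from search_inv_walk[OF F q s0] show "m \<le> ereal (awalk_cost w q)"
    proof (elim disjE exE conjE)
      \<comment> \<open>The forward bound reaches \<open>t\<close> itself, where the backward
        distance is at most 0.\<close>
      assume "tdist F t \<le> ereal (0 + awalk_cost w q)"
      from add_mono[OF this t0] m[of t] show ?thesis by simp
    next
      fix q1 q2 x
      assume x: "q = q1 @ q2" "awalk s q1 x" "awalk x q2 t" "x \<in> queue F"
        "tdist F x \<le> ereal (0 + awalk_cost w q1)"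
      \<comment> \<open>Only the part after \<open>x\<close> is traced back from \<open>t\<close>,
        so a backward queue vertex found on it lies at or behind \<open>x\<close>.\<close>
      have "pre_digraph.awalk (reverse_digraph G) t (rev q2) x" by (rule awalk_rev[OF x(3)])
      from fin_digraph.search_inv_walk[OF fin_digraph_reverse B this t0] show ?thesis
      proof (elim disjE exE conjE)
        assume "tdist B x \<le> ereal (0 + awalk_cost w (rev q2))"
        from add_mono[OF x(5) this] m[of x] x(1) show ?thesis by simp
      next
        fix r1 r2 y
        assume y: "rev q2 = r1 @ r2" "pre_digraph.awalk (reverse_digraph G) y r2 x" "y \<in> queue B"
          "tdist B y \<le> ereal (0 + awalk_cost w r1)"
        \<comment> \<open>The walk is now cut into \<open>q1\<close> from \<open>s\<close> to
          \<open>x\<close>, \<open>rev r2\<close> from \<open>x\<close> to \<open>y\<close> and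
          \<open>rev r1\<close> from \<open>y\<close> to \<open>t\<close>.\<close>
        have "awalk_cost w (rev q2) = awalk_cost w r1 + awalk_cost w r2" unfolding y(1) by simp
        then have cost: "awalk_cost w q = awalk_cost w q1 + awalk_cost w r2 + awalk_cost w r1"
          using x(1) by simp
        have "awalk x (rev r2) y" using y(2) unfolding awalk_reverse_iff .
        then have px: "p x \<le> awalk_cost w r2 + p y"
          using consistent_walk[OF con] by fastforce
        \<comment> \<open>The two keys sum to at most the costs of the outer pieces plus
          \<open>p x - p y\<close>, and by \<open>px\<close> this difference is at most the cost of
          the middle piece.\<close>
        have "m \<le> key p F x + key (\<lambda>v. - p v) B y"
          using stop unfolding top_key_def
          by (rule order_trans) (intro add_mono INF_lower x(4) y(3))
        also have "\<dots> \<le> ereal (awalk_cost w q1 + p x) + ereal (awalk_cost w r1 - p y)"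
          using add_right_mono[OF x(5), of "ereal (p x)"] add_right_mono[OF y(4), of "ereal (- p y)"]
          unfolding key_def by (intro add_mono) auto
        also have "\<dots> \<le> ereal (awalk_cost w q)" using px by (simp add: cost)
        finally show ?thesis .
      qed
    qed
  qed
qed

text \<open>Each step settles one more vertex in one of the two searches, so the total number of
  unsettled vertices decreases.\<close>

lemma biastar_returns:
  assumes con: "consistent G w p" and s: "s \<in> verts G" and t: "t \<in> verts G"
  shows "always_returns (biastar_step G w p (\<lambda>v. - p v)) (init_bisearch s t) (\<mu> w s t)"
proof (rule always_returnsI[where Inv = "bisearch_inv G w p s t" and
      f = "\<lambda>(F, B, m). card (verts G - settled F) + card (verts G - settled B)"])
  show "bisearch_inv G w p s t (init_bisearch s t)" by (rule bisearch_inv_init[OF s t])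
next
  fix X Y
  assume inv: "bisearch_inv G w p s t X"
    and step: "biastar_step G w p (\<lambda>v. - p v) (Running X) (Running Y)"
  from step show "bisearch_inv G w p s t Y \<and>
      (case Y of (F, B, m) \<Rightarrow> card (verts G - settled F) + card (verts G - settled B))
      < (case X of (F, B, m) \<Rightarrow> card (verts G - settled F) + card (verts G - settled B))"
  proof (cases rule: biastar_step.cases)
    case (forward F B m v)
    then show ?thesis
      using bisearch_inv_forward[OF con, of s t F B m v] scan_measure_less[OF con, of s F v] inv
      by (auto simp: bisearch_inv.simps)
  next
    case (backward F B m v)
    then show ?thesis
      using bisearch_inv_backward[OF con, of s t F B m v] inv
        fin_digraph.scan_measure_less[OF fin_digraph_reverse consistent_reverse_digraph[OF con], of t B v]
      by (auto simp: bisearch_inv.simps)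
  qed
next
  fix X r
  assume "bisearch_inv G w p s t X" "biastar_step G w p (\<lambda>v. - p v) (Running X) (Returned r)"
  then show "r = \<mu> w s t"
    using stop_correct[OF con] by (auto elim: biastar_step.cases)
next
  fix X assume inv: "bisearch_inv G w p s t X"
  obtain F B m where X: "X = (F, B, m)" by (cases X)
  show "\<exists>z. biastar_step G w p (\<lambda>v. - p v) (Running X) z"
  proof (cases "m \<le> top_key p F + top_key (\<lambda>v. - p v) B")
    case True
    then show ?thesis unfolding X by (blast intro: biastar_step.stop)
  next
    case False
    then have less: "top_key p F + top_key (\<lambda>v. - p v) B < m" by simp
    \<comment> \<open>An empty forward queue has top key \<infinity>, and in \<open>ereal\<close>
      the sum is then \<infinity> whatever the other key is, so it cannot be below
      \<open>m\<close>.\<close>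
    then have "queue F \<noteq> {}" by (auto simp: top_key_def top_ereal_def)
    then obtain v where "is_min p F v"
      using inv search_inv_is_min_ex unfolding X bisearch_inv.simps by blast
    then show ?thesis using less unfolding X by (blast intro: biastar_step.forward)
  qed
next
  show "\<not> biastar_step G w p (\<lambda>v. - p v) (Returned q) z" for q z
    by (auto elim: biastar_step.cases)
qed

end

section \<open>Distances in the query graph\<close>

lemma Max_le_add_Max:
  fixes f g :: "'c \<Rightarrow> real"
  assumes "finite S" "0 \<le> c" "\<And>L. L \<in> S \<Longrightarrow> f L \<le> c + g L"
  shows "Max (f ` S) \<le> c + Max (g ` S)"
\<comment> \<open>For empty \<open>S\<close> both maxima are the same unspecified number and the
  claim reduces to \<open>0 \<le> c\<close>.\<close>
proof (cases "S = {}")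
  case False
  have "f L \<le> c + Max (g ` S)" if "L \<in> S" for L
  proof -
    have "g L \<le> Max (g ` S)" using that assms(1) by simp
    then show ?thesis using assms(3)[OF that] by linarith
  qed
  then show ?thesis using assms(1) False by simp
qed (use assms in simp)

section \<open>Cells of a partition and the components of the query graph\<close>

lemma cell_eqI:
  assumes "partition_on A C" "c \<in> C" "v \<in> c"
  shows "cell C v = c"
  unfolding cell_def
  using assms by (auto simp: partition_on_def disjoint_def intro!: the_equality)

lemma cell_in_partition:
  assumes "partition_on A C" "v \<in> A"
  shows "cell C v \<in> C" "v \<in> cell C v"
proof -
  obtain c where "c \<in> C" "v \<in> c" using assms by (auto simp: partition_on_def)
  then show "cell C v \<in> C" "v \<in> cell C v" using cell_eqI[OF assms(1)] by simp_all
qed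

lemma cell_subset:
  assumes "partition_on A C" "v \<in> A"
  shows "cell C v \<subseteq> A"
  using cell_in_partition(1)[OF assms] assms(1) by (auto simp: partition_on_def)

lemma query_graph_simps [simp]:
  "verts (query_graph G w C s t) = boundary_verts G C \<union> cell C s \<union> cell C t"
  "arcs (query_graph G w C s t) = Inl ` boundary_arcs G C \<union> Inr ` clique_arcs G w C \<union>
    Inl ` arcs (G \<restriction> cell C s) \<union> Inl ` arcs (G \<restriction> cell C t)"
  "tail (query_graph G w C s t) = case_sum (tail G) fst"
  "head (query_graph G w C s t) = case_sum (head G) snd"
  by (simp_all add: query_graph_def overlay_def Let_def)

lemma overlay_weight_simps [simp]:
  "overlay_weight G w C (Inl e) = w e"
  "overlay_weight G w C (Inr (u, v)) = real_of_ereal (sp_dist (G \<restriction> cell C u) w u v)"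
  by (simp_all add: overlay_weight_def)

section \<open>Triangle inequality and Lipschitz bounds for landmarks\<close>

context fin_digraph
begin

lemma mu_nonneg:
  assumes "\<forall>e\<in>arcs G. 0 \<le> w e"
  shows "0 \<le> \<mu> w u v"
  unfolding \<mu>_def
  using pos_cost_pos_awalk_cost[of u _ v w] assms by (auto intro!: INF_greatest)

text \<open>Nonnegative weights make finite distances attained, so shortest walks can be
  concatenated; otherwise the right side is \<infinity>.\<close>

lemma mu_triangle:
  assumes nonneg: "\<forall>e\<in>arcs G. 0 \<le> w e"
  shows "\<mu> w u v \<le> \<mu> w u x + \<mu> w x v"
proof (cases "\<mu> w u x < \<infinity> \<and> \<mu> w x v < \<infinity>")
  case True
  then obtain q r where "awalk u q x" "\<mu> w u x = awalk_cost w q"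
    "awalk x r v" "\<mu> w x v = awalk_cost w r"
    using min_cost_awalk[of u x w] min_cost_awalk[of x v w] nonneg
    unfolding \<mu>_reach_conv apath_def by blast
  then show ?thesis using min_cost_le_walk_cost[OF awalk_appendI, of u q x r v w] by simp
next
  case False
  then show ?thesis by auto
qed

lemma mu_induce_ge:
  assumes "c \<subseteq> verts G"
  shows "\<mu> w u v \<le> sp_dist (G \<restriction> c) w u v"
proof -
  interpret c: wf_digraph "G \<restriction> c" by (rule wellformed_induce_subgraph)
  show ?thesis
    unfolding c.\<mu>_def
    using subgraph_awalk_imp_awalk[OF _ subgraph_induce_subgraphI[OF assms]] min_cost_le_walk_cost
    by (auto intro!: INF_greatest)
qed

text \<open>By the triangle inequality every landmark term changes by at most \<open>c\<close>,
  hence so does the maximum. Any \<open>c\<close> above the distance is allowed, which covers clique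
  arcs as well.\<close>

lemma landmark_bound_arc:
  assumes nonneg: "\<forall>e\<in>arcs G. 0 \<le> w e" and S: "S \<subseteq> verts G"
    and fin: "\<forall>L\<in>S. \<forall>v\<in>verts G. \<mu> w v L \<noteq> \<infinity> \<and> \<mu> w L v \<noteq> \<infinity>"
    and uv: "u \<in> verts G" "v \<in> verts G" and le: "\<mu> w u v \<le> ereal c"
  shows "landmark_bound G w S u t \<le> c + landmark_bound G w S v t"
    and "landmark_bound G w S s v \<le> c + landmark_bound G w S s u"
proof -
  define d where "d x y = real_of_ereal (\<mu> w x y)" for x y
  have finS: "finite S" using S finite_verts by (rule finite_subset)
  have "ereal 0 \<le> ereal c"
    using order_trans[OF mu_nonneg[OF nonneg] le] by (simp add: zero_ereal_def)
  then have c: "0 \<le> c" by simp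
  \<comment> \<open>Distances to and from landmarks are finite, so passing to reals loses
    nothing.\<close>
  have d: "\<mu> w L x = ereal (d L x)" "\<mu> w x L = ereal (d x L)" if "L \<in> S" "x \<in> verts G" for L x
    using fin that mu_nonneg[OF nonneg, of L x] mu_nonneg[OF nonneg, of x L]
    unfolding d_def by (auto simp: ereal_real')
  have to_L: "d u L \<le> c + d v L" and from_L: "d L v \<le> d L u + c" if L: "L \<in> S" for L
  proof -
    have "\<mu> w u L \<le> ereal c + \<mu> w v L"
      using mu_triangle[OF nonneg, of u L v] add_right_mono[OF le, of "\<mu> w v L"] by (rule order_trans)
    then show "d u L \<le> c + d v L" using d[OF L] uv by simp
    have "\<mu> w L v \<le> \<mu> w L u + ereal c"
      using mu_triangle[OF nonneg, of L v u] add_left_mono[OF le, of "\<mu> w L u"] by (rule order_trans)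
    then show "d L v \<le> d L u + c" using d[OF L] uv by simp
  qed
  show "landmark_bound G w S u t \<le> c + landmark_bound G w S v t"
    unfolding landmark_bound_def Let_def d_def[symmetric]
  proof (rule Max_le_add_Max[OF finS c])
    fix L assume "L \<in> S"
    from to_L[OF this] from_L[OF this]
    show "max (d u L - d t L) (d L t - d L u) \<le> c + max (d v L - d t L) (d L t - d L v)" by linarith
  qed
  show "landmark_bound G w S s v \<le> c + landmark_bound G w S s u"
    unfolding landmark_bound_def Let_def d_def[symmetric]
  proof (rule Max_le_add_Max[OF finS c])
    fix L assume "L \<in> S"
    from to_L[OF this] from_L[OF this]
    show "max (d s L - d v L) (d L v - d L s) \<le> c + max (d s L - d u L) (d L u - d L s)" by linarith
  qed
qed

end

section \<open>Comparison of the query graph with \<open>G\<close>\<close>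

locale overlay_query = fin_digraph G for G :: "('a, 'b) pre_digraph" (structure) +
  fixes w :: "'b \<Rightarrow> real" and C :: "'a set set" and s t :: 'a
  assumes nonneg: "\<forall>e\<in>arcs G. 0 \<le> w e"
    and partition: "partition_on (verts G) C"
    and s: "s \<in> verts G" and t: "t \<in> verts G"
begin

abbreviation Q where "Q \<equiv> query_graph G w C s t"
abbreviation W where "W \<equiv> overlay_weight G w C"

lemma boundary_verts_subset: "boundary_verts G C \<subseteq> verts G"
  by (auto simp: boundary_verts_def)

lemma query_verts_subset: "verts Q \<subseteq> verts G"
  using boundary_verts_subset cell_subset[OF partition s] cell_subset[OF partition t] by simp

lemma fin_digraph_query: "fin_digraph Q"
proof
  show "finite (verts Q)" using query_verts_subset finite_verts by (rule finite_subset)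
  have "clique_arcs G w C \<subseteq> verts G \<times> verts G"
    using boundary_verts_subset by (auto simp: clique_arcs_def)
  then have "finite (clique_arcs G w C)" by (rule finite_subset) simp
  then show "finite (arcs Q)" by (simp add: boundary_arcs_def)
  fix e assume e: "e \<in> arcs Q"
  then show "tail Q e \<in> verts Q"
    by (auto simp: clique_arcs_def boundary_verts_def boundary_arcs_def)
  from e show "head Q e \<in> verts Q"
    by (auto simp: clique_arcs_def boundary_verts_def boundary_arcs_def)
qed

sublocale Q: fin_digraph Q by (rule fin_digraph_query)

lemma s_in_query: "s \<in> verts Q" and t_in_query: "t \<in> verts Q"
  using cell_in_partition(2)[OF partition] s t by simp_all

text \<open>An original arc is a walk of length one. The weight of a clique arc is a distance inside
  a cell, and walks inside a cell are walks of \<open>G\<close>.\<close>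

lemma mu_le_query_arc:
  assumes "e \<in> arcs Q"
  shows "\<mu> w (tail Q e) (head Q e) \<le> ereal (W e)"
proof (cases e)
  case (Inl a)
  then have "a \<in> arcs G" using assms by (auto simp: boundary_arcs_def)
  then have "awalk (tail G a) [a] (head G a)" by (simp add: awalk_simps)
  from min_cost_le_walk_cost[OF this, of w] show ?thesis by (simp add: Inl)
next
  case (Inr a)
  obtain u v where a: "a = (u, v)" by (cases a)
  then obtain c where c: "c \<in> C" "u \<in> c" and fin: "sp_dist (G \<restriction> c) w u v \<noteq> \<infinity>"
    using assms Inr by (auto simp: clique_arcs_def)
  have cell: "cell C u = c" using cell_eqI[OF partition] c by blast
  have "c \<subseteq> verts G" using c(1) partition by (auto simp: partition_on_def)
  then have le: "\<mu> w u v \<le> sp_dist (G \<restriction> c) w u v" by (rule mu_induce_ge)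
  \<comment> \<open>Both infinite values must be excluded for \<open>real_of_ereal\<close> in the
    weight to be exact.\<close>
  then have "sp_dist (G \<restriction> c) w u v \<noteq> - \<infinity>" using mu_nonneg[OF nonneg, of u v] by auto
  then have "\<bar>sp_dist (G \<restriction> c) w u v\<bar> \<noteq> \<infinity>" using fin by (intro ereal_infinity_cases)
  then have "sp_dist (G \<restriction> c) w u v = ereal (W e)" by (simp add: Inr a cell ereal_real')
  then show ?thesis using le by (simp add: Inr a)
qed

lemma mu_le_query_walk:
  assumes "Q.awalk u q v"
  shows "\<mu> w u v \<le> ereal (Q.awalk_cost W q)"
  using assms
proof (induction q arbitrary: u)
  case Nil
  then have "u = v" "u \<in> verts G" using query_verts_subset by (auto simp: Q.awalk_Nil_iff)
  then have "awalk u [] v" by (simp add: awalk_Nil_iff)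
  from min_cost_le_walk_cost[OF this, of w] show ?case by simp
next
  case (Cons e q)
  then have e: "e \<in> arcs Q" "u = tail Q e" "Q.awalk (head Q e) q v"
    by (auto simp: Q.awalk_Cons_iff)
  have "\<mu> w u v \<le> \<mu> w u (head Q e) + \<mu> w (head Q e) v" by (rule mu_triangle[OF nonneg])
  also have "\<dots> \<le> ereal (W e) + ereal (Q.awalk_cost W q)"
    using mu_le_query_arc[OF e(1)] Cons.IH[OF e(3)] e(2) by (intro add_mono) auto
  finally show ?case by simp
qed

lemma query_walk_in_cell:
  assumes "x = s \<or> x = t" "pre_digraph.awalk (G \<restriction> cell C x) u r v"
  shows "Q.awalk u (map Inl r) v \<and> Q.awalk_cost W (map Inl r) = awalk_cost w r"
proof -
  interpret c: wf_digraph "G \<restriction> cell C x" by (rule wellformed_induce_subgraph)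
  show ?thesis using assms(2)
  proof (induction r arbitrary: u)
    case Nil
    then show ?case using assms(1) by (auto simp: Q.awalk_Nil_iff c.awalk_Nil_iff)
  next
    case (Cons e r)
    then have "e \<in> arcs (G \<restriction> cell C x)" "u = tail G e" "c.awalk (head G e) r v"
      by (auto simp: c.awalk_Cons_iff)
    then show ?case using Cons.IH assms(1) by (auto simp: Q.awalk_Cons_iff)
  qed
qed

text \<open>A piece between boundary vertices of one cell is replaced by a clique arc, which is no
  longer than it. A piece starting at \<open>s\<close> stays in the cell of \<open>s\<close> and is
  kept arc by arc.\<close>

lemma query_walk_to_boundary:
  assumes v: "v \<in> boundary_verts G C" and u: "u = s \<or> u \<in> boundary_verts G C"
    and uc: "u \<in> cell C v" and r: "pre_digraph.awalk (G \<restriction> cell C v) u r v"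
  obtains q where "Q.awalk u q v" "Q.awalk_cost W q \<le> awalk_cost w r"
proof -
  interpret c: wf_digraph "G \<restriction> cell C v" by (rule wellformed_induce_subgraph)
  have "v \<in> verts G" using v boundary_verts_subset by blast
  note cv = cell_in_partition[OF partition this]
  have cu: "cell C u = cell C v" by (rule cell_eqI[OF partition cv(1) uc])
  show thesis
  proof (cases "u = s")
    case True
    then show thesis using query_walk_in_cell[of s u r v] r cu that by force
  next
    case False
    have le: "c.\<mu> w u v \<le> ereal (awalk_cost w r)" using c.min_cost_le_walk_cost[OF r] by simp
    then have "c.\<mu> w u v \<noteq> \<infinity>" by auto
    \<comment> \<open>For \<open>u = v\<close> this is a loop, so no separate case arises.\<close>
    then have "(u, v) \<in> clique_arcs G w C"
      unfolding clique_arcs_def using False u v uc cv by blast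
    then have e: "Inr (u, v) \<in> arcs Q" by simp
    have "c.\<mu> w u v = ereal (W (Inr (u, v)))"
      using \<open>c.\<mu> w u v \<noteq> \<infinity>\<close> mu_nonneg[OF nonneg, of u v]
        mu_induce_ge[OF cell_subset[OF partition \<open>v \<in> verts G\<close>], of w u v]
      by (auto simp: cu ereal_real')
    then have "W (Inr (u, v)) \<le> awalk_cost w r" using le by simp
    moreover have "Q.awalk u [Inr (u, v)] v"
      using e Q.head_in_verts[OF e] by (simp add: Q.awalk_simps)
    ultimately show thesis using that[of "[Inr (u, v)]"] by simp
  qed
qed

text \<open>Here \<open>u\<close> is \<open>s\<close> or the vertex where the walk last entered the
  cell of \<open>v\<close>. The piece \<open>r\<close> after \<open>u\<close> stays untranslated,
  because only on leaving the cell is its end known to be a boundary vertex.\<close>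

lemma walk_decomposition:
  assumes "awalk s p v"
  shows "\<exists>u q r. (u = s \<or> u \<in> boundary_verts G C) \<and> u \<in> cell C v \<and> Q.awalk s q u \<and>
    pre_digraph.awalk (G \<restriction> cell C v) u r v \<and>
    Q.awalk_cost W q + awalk_cost w r \<le> awalk_cost w p"
  using assms
proof (induction p arbitrary: v rule: rev_induct)
  case Nil
  interpret c: wf_digraph "G \<restriction> cell C s" by (rule wellformed_induce_subgraph)
  have "s \<in> cell C s" by (rule cell_in_partition(2)[OF partition s])
  then have "Q.awalk s [] s" "c.awalk s [] s" by (simp_all add: Q.awalk_Nil_iff c.awalk_Nil_iff)
  moreover have "v = s" using Nil by (simp add: awalk_Nil_iff)
  ultimately show ?case using \<open>s \<in> cell C s\<close>
    by (intro exI[of _ s] exI[of _ "[]"]) simp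
next
  case (snoc e p)
  then have e: "e \<in> arcs G" "v = head G e" "awalk s p (tail G e)"
    by (auto simp: awalk_simps)
  from snoc.IH[OF e(3)] obtain u q r where
    u: "u = s \<or> u \<in> boundary_verts G C" "u \<in> cell C (tail G e)" and q: "Q.awalk s q u"
    and r: "pre_digraph.awalk (G \<restriction> cell C (tail G e)) u r (tail G e)"
    and cost: "Q.awalk_cost W q + awalk_cost w r \<le> awalk_cost w p"
    by blast
  have cells: "tail G e \<in> cell C (tail G e)" "head G e \<in> cell C (head G e)"
    using cell_in_partition(2)[OF partition] e(1) by simp_all
  interpret c: wf_digraph "G \<restriction> cell C v" by (rule wellformed_induce_subgraph)
  show ?case
  proof (cases "cell C (tail G e) = cell C (head G e)")
    case True
    then have "c.awalk (tail G e) [e] v"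
      using e(1) cells by (simp add: c.awalk_simps flip: e(2))
    then have "c.awalk u (r @ [e]) v"
      using r True e(2) c.awalk_appendI by simp
    then show ?thesis
      using u q cost True e(2) by (intro exI[of _ u] exI[of _ q] exI[of _ "r @ [e]"]) simp
  next
    case False
    then have b: "e \<in> boundary_arcs G C" using e(1) by (simp add: boundary_arcs_def)
    then have bv: "tail G e \<in> boundary_verts G C" "v \<in> boundary_verts G C"
      using e by (auto simp: boundary_verts_def)
    \<comment> \<open>On leaving the cell the pending piece \<open>r\<close> becomes a query walk;
      the crossing arc is appended and an empty piece starts at \<open>v\<close>.\<close>
    obtain q' where q': "Q.awalk u q' (tail G e)" "Q.awalk_cost W q' \<le> awalk_cost w r"
      using query_walk_to_boundary[OF bv(1) u r] .
    have "Q.awalk (tail G e) [Inl e] v"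
      using b e(2) bv(2) by (simp add: Q.awalk_simps)
    then have "Q.awalk s (q @ q' @ [Inl e]) v"
      using q q'(1) by (blast intro: Q.awalk_appendI)
    moreover have "c.awalk v [] v" using cells(2) by (simp add: c.awalk_Nil_iff flip: e(2))
    ultimately show ?thesis
      using bv(2) q'(2) cost cells(2)
      by (intro exI[of _ v] exI[of _ "q @ q' @ [Inl e]"] exI[of _ "[]"]) (simp flip: e(2))
  qed
qed

lemma query_mu: "Q.\<mu> W s t = \<mu> w s t"
proof (rule antisym)
  show "\<mu> w s t \<le> Q.\<mu> W s t"
    unfolding Q.\<mu>_def using mu_le_query_walk by (auto intro!: INF_greatest)
  show "Q.\<mu> W s t \<le> \<mu> w s t"
    unfolding \<mu>_def
  proof (rule INF_greatest, clarify)
    fix p assume "awalk s p t"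
    from walk_decomposition[OF this] obtain u q r where q: "Q.awalk s q u"
      and r: "pre_digraph.awalk (G \<restriction> cell C t) u r t"
      and cost: "Q.awalk_cost W q + awalk_cost w r \<le> awalk_cost w p"
      by blast
    \<comment> \<open>The last piece lies in the cell of \<open>t\<close>, all of whose arcs are in
      the query graph.\<close>
    from query_walk_in_cell[OF _ r] have r': "Q.awalk u (map Inl r) t"
      "Q.awalk_cost W (map Inl r) = awalk_cost w r" by simp_all
    have "Q.\<mu> W s t \<le> ereal (Q.awalk_cost W (q @ map Inl r))"
      using q r'(1) by (blast intro: Q.min_cost_le_walk_cost Q.awalk_appendI)
    also have "\<dots> \<le> ereal (awalk_cost w p)" using cost r'(2) by simp
    finally show "Q.\<mu> W s t \<le> ereal (awalk_cost w p)" .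
  qed
qed

lemma consistent_landmark_potentials:
  assumes S: "S \<subseteq> verts G"
    and fin: "\<forall>L\<in>S. \<forall>v\<in>verts G. \<mu> w v L \<noteq> \<infinity> \<and> \<mu> w L v \<noteq> \<infinity>"
  shows "consistent Q W (\<lambda>v. landmark_bound G w S v t)"
    and "consistent Q W (forward_potential G w S s t)"
proof -
  have bounds: "landmark_bound G w S (tail Q e) t \<le> W e + landmark_bound G w S (head Q e) t"
    "landmark_bound G w S s (head Q e) \<le> W e + landmark_bound G w S s (tail Q e)"
    if "e \<in> arcs Q" for e
  proof -
    have "tail Q e \<in> verts G" "head Q e \<in> verts G"
      using Q.tail_in_verts[OF that] Q.head_in_verts[OF that] query_verts_subset by blast+
    note landmark_bound_arc[OF nonneg S fin this mu_le_query_arc[OF that]]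
    then show "landmark_bound G w S (tail Q e) t \<le> W e + landmark_bound G w S (head Q e) t"
      "landmark_bound G w S s (head Q e) \<le> W e + landmark_bound G w S s (tail Q e)" .
  qed
  show "consistent Q W (\<lambda>v. landmark_bound G w S v t)"
    using bounds(1) by (simp only: consistent_def) blast
  \<comment> \<open>The forward potential is the average of \<pi>(v,t) and -\<pi>(s,v), both
    consistent by \<open>bounds\<close>.\<close>
  have half: "(a - b) / 2 \<le> x + (c - d) / 2" if "a \<le> x + c" "d \<le> x + b" for a b c d x :: real
    using that by (simp add: field_simps)
  show "consistent Q W (forward_potential G w S s t)"
    unfolding consistent_def forward_potential_def
  proof
    fix e assume "e \<in> arcs Q"
    from half[OF bounds[OF this]] show
      "(landmark_bound G w S (tail Q e) t - landmark_bound G w S s (tail Q e)) / 2 \<le>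
        W e + (landmark_bound G w S (head Q e) t - landmark_bound G w S s (head Q e)) / 2"
      .
  qed
qed

end

theorem theorem1:
  fixes G :: "('a, 'b) pre_digraph" and w :: "'b \<Rightarrow> real"
    and C :: "'a set set" and S :: "'a set" and s t :: 'a
  assumes "fin_digraph G"
    and "\<forall>e\<in>arcs G. 0 < w e"
    and "partition_on (verts G) C"
    and "S \<subseteq> verts G"
    and "\<forall>L\<in>S. \<forall>v\<in>verts G. sp_dist G w v L \<noteq> \<infinity> \<and> sp_dist G w L v \<noteq> \<infinity>"
    and "s \<in> verts G" and "t \<in> verts G"
  shows "always_returns (salt_p2p_step G w C S s t) (init_search s) (sp_dist G w s t) \<and>
    always_returns (bi_salt_p2p_step G w C S s t) (init_bisearch s t) (sp_dist G w s t)"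
proof -
  interpret fin_digraph G by fact
  interpret overlay_query G w C s t
    using assms by unfold_locales (auto intro: less_imp_le)
  note con = consistent_landmark_potentials[OF assms(4,5)]
  show ?thesis
    using conjI[OF Q.astar_returns[OF con(1) s_in_query, of t]
        Q.biastar_returns[OF con(2) s_in_query t_in_query]]
    unfolding query_mu salt_p2p_step_def bi_salt_p2p_step_def .
qed

end
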